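(* Let $o_0=1,o_1,\dots,o_7$ be the standard basis of the octonion algebra $\mathbb{O}$, and for $u\in\mathbb{R}^7$ put $o_u=u_1o_1+\dots+u_7o_7$. Then the cubic form $$f(u,v,w)=\mathrm{Re}\,\big(o_u(o_vo_w)\big),\qquad (u,v,w)\in\mathbb{R}^7\times\mathbb{R}^7\times\mathbb{R}^7=\mathbb{R}^{21},$$ is an exceptional radial eigencubic in $\mathbb{R}^{21}$ of type $(4,5)$.
   Context: The octonion multiplication is given by $o_i\cdot o_{i+1}=o_{i+3}$ with indices permuted cyclically and translated modulo 7 (and $o_i^2=-1$, $o_io_j=-o_jo_i$ for $i\neq j$, $i,j\ge1$). For a polynomial $f$ on $\mathbb{R}^n$ put $L(f)=|\nabla f|^2\Delta f-\sum_{i,j=1}^n f_{x_i}f_{x_j}f_{x_ix_j}$. A radial eigencubic in $\mathbb{R}^n$ is a homogeneous polynomial $f\not\equiv 0$ of degree 3 such that $L(f)=\lambda |x|^2 f$ for some constant $\lambda\in\mathbb{R}$, where it is assumed that $\lambda\neq 0$. Two cubic forms $f_1,f_2$ on $\mathbb{R}^n$ are congruent if $f_1(x)=cf_2(Ux)$ for some $U\in O(n)$ and some real $c\ne0$. Every radial eigencubic admits a normal form: an orthogonal decomposition $\mathbb{R}^n=\mathrm{span}(e_n)\oplus V_1\oplus V_2\oplus V_3$ ($e_n$ a unit vector, the $V_i$ possibly zero) such that, writing $x=x_ne_n+\xi+\eta+\zeta$ with $\xi\in V_1,\eta\in V_2,\zeta\in V_3$, after multiplication of $f$ by a nonzero constant,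 $$f=x_n^3-\tfrac32x_n(2|\xi|^2+|\eta|^2-|\zeta|^2)+\psi_{111}+\psi_{102}+\psi_{012}+\psi_{030},$$ where $\psi_{ijk}$ is homogeneous of degree $i$ in $\xi$, $j$ in $\eta$ and $k$ in $\zeta$. The type of $f$ is the pair $(n_1,n_2)=(\dim V_1,\dim V_2)$, which is independent of the normal form. For $m\ge1$, $q\ge0$, a symmetric Clifford system $\mathcal{A}=\{A_0,\dots,A_q\}\in\mathrm{Cliff}(\mathbb{R}^{2m},q)$ is a system of symmetric endomorphisms of $\mathbb{R}^{2m}$ with $A_iA_j+A_jA_i=2\delta_{ij}\mathbf{1}$ (and, when $q=0$, $\operatorname{tr}A_0=0$). To it one associates the radial eigencubic $C_{\mathcal A}(z,y)=\sum_{i=0}^q\langle y,A_iy\rangle z_{i+1}$ on $\mathbb{R}^{q+1}\times\mathbb{R}^{2m}$. A radial eigencubic is exceptional if it is not congruent to any $C_{\mathcal A}$. *)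

theory Defs
  imports "HOL-Analysis.Analysis" "Jordan_Normal_Form.Matrix"
begin

(* These symbols clash with inner and vec_nth from HOL-Analysis, which keep them here. *)
no_notation Matrix.scalar_prod (infix "\<bullet>" 70)
no_notation Matrix.vec_index (infixl "$" 100)

section \<open>Octonions\<close>

text \<open>
  An octonion is a pair of its real part and its imaginary part. The type \<open>7\<close> is the ring of
  integers modulo 7, so index arithmetic in it is modulo 7 and the index 7 is the element 0.
\<close>

type_synonym octonion = "real \<times> (real ^ 7)"

definition oct_re :: "octonion \<Rightarrow> real" where
  "oct_re a = fst a"

definition oct_unit :: "7 \<Rightarrow> octonion" where
  "oct_unit i = (0, axis i 1)"

definition oct_of :: "real ^ 7 \<Rightarrow> octonion" where
  "oct_of u = (\<Sum>i\<in>UNIV. (u $ i) *\<^sub>R oct_unit i)"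

definition fano :: "7 \<Rightarrow> 7 \<Rightarrow> 7 \<Rightarrow> bool" where
  "fano i j k \<longleftrightarrow>
     (\<exists>l. (i, j, k) \<in> {(l, l + 1, l + 3), (l + 1, l + 3, l), (l + 3, l, l + 1)})"

text \<open>The coefficient of \<open>oct_unit k\<close> in \<open>oct_unit i\<close> times \<open>oct_unit j\<close>.\<close>

definition oct_coeff :: "7 \<Rightarrow> 7 \<Rightarrow> 7 \<Rightarrow> real" where
  "oct_coeff i j k = (if fano i j k then 1 else if fano j i k then - 1 else 0)"

definition oct_mult :: "octonion \<Rightarrow> octonion \<Rightarrow> octonion" (infixl "*\<^sub>o" 70) where
  "oct_mult a b =
     (fst a * fst b - snd a \<bullet> snd b,
      fst a *\<^sub>R snd b + fst b *\<^sub>R snd a +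
        (\<chi> k. \<Sum>i\<in>UNIV. \<Sum>j\<in>UNIV. oct_coeff i j k * (snd a $ i) * (snd b $ j)))"

lemma oct_mult_one: "(1, 0) *\<^sub>o a = a" "a *\<^sub>o (1, 0) = a"
  by (simp_all add: oct_mult_def prod_eq_iff Finite_Cartesian_Product.vec_eq_iff)

lemma oct_unit_mult:
  "oct_unit i *\<^sub>o oct_unit j = (if i = j then - 1 else 0, \<chi> k. oct_coeff i j k)"
proof -
  have "(\<Sum>i'\<in>UNIV. \<Sum>j'\<in>UNIV. oct_coeff i' j' k * axis i 1 $ i' * axis j 1 $ j') =
      (\<Sum>i'\<in>UNIV. \<Sum>j'\<in>UNIV. if i' = i then if j' = j then oct_coeff i j k else 0 else 0)" for k
    by (intro sum.cong) (auto simp: axis_def)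
  also have "\<dots> k = oct_coeff i j k" for k
    by (simp add: sum.swap[of _ UNIV UNIV])
  finally show ?thesis
    by (simp add: oct_mult_def oct_unit_def inner_axis_axis)
qed

lemma fano_iff:
  "fano i j k \<longleftrightarrow> j = i + 1 \<and> k = i + 3 \<or> j = i + 2 \<and> k = i + 6 \<or> j = i + 4 \<and> k = i + 5"
proof
  assume "fano i j k"
  then show "j = i + 1 \<and> k = i + 3 \<or> j = i + 2 \<and> k = i + 6 \<or> j = i + 4 \<and> k = i + 5"
    by (auto simp: fano_def add.assoc)
next
  assume "j = i + 1 \<and> k = i + 3 \<or> j = i + 2 \<and> k = i + 6 \<or> j = i + 4 \<and> k = i + 5"
  then show "fano i j k"
  proof (elim disjE conjE)
    assume "j = i + 1" "k = i + 3"
    then show ?thesis unfolding fano_def by (intro exI[of _ i]) simp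
  next
    assume "j = i + 2" "k = i + 6"
    then show ?thesis unfolding fano_def by (intro exI[of _ "i + 6"]) (simp add: add.assoc)
  next
    assume "j = i + 4" "k = i + 5"
    then show ?thesis unfolding fano_def by (intro exI[of _ "i + 4"]) (simp add: add.assoc)
  qed
qed

lemma oct_unit_table:
  shows "oct_unit i *\<^sub>o oct_unit i = (- 1, 0)"
    and "i \<noteq> j \<Longrightarrow> oct_unit i *\<^sub>o oct_unit j = - (oct_unit j *\<^sub>o oct_unit i)"
    and "oct_unit i *\<^sub>o oct_unit (i + 1) = oct_unit (i + 3)"
    and "oct_unit (i + 1) *\<^sub>o oct_unit (i + 3) = oct_unit i"
    and "oct_unit (i + 3) *\<^sub>o oct_unit i = oct_unit (i + 1)"
proof -
  have asym: "\<not> (fano i j k \<and> fano j i k)" for i j k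
    by (auto simp: fano_iff add.assoc)
  have diag: "oct_coeff i i k = 0" for i k
    by (simp add: oct_coeff_def fano_iff)
  show "oct_unit i *\<^sub>o oct_unit i = (- 1, 0)"
    by (simp add: oct_unit_mult diag flip: Finite_Cartesian_Product.zero_vec_def)
  show "oct_unit i *\<^sub>o oct_unit j = - (oct_unit j *\<^sub>o oct_unit i)" if "i \<noteq> j"
    using that asym[of i j] by (auto simp: oct_unit_mult Finite_Cartesian_Product.vec_eq_iff oct_coeff_def)
  show "oct_unit i *\<^sub>o oct_unit (i + 1) = oct_unit (i + 3)"
    unfolding oct_unit_mult
    by (auto simp: oct_unit_def Finite_Cartesian_Product.vec_eq_iff oct_coeff_def axis_def fano_iff add.assoc)
  show "oct_unit (i + 1) *\<^sub>o oct_unit (i + 3) = oct_unit i"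
    unfolding oct_unit_mult
    by (auto simp: oct_unit_def Finite_Cartesian_Product.vec_eq_iff oct_coeff_def axis_def fano_iff add.assoc)
  show "oct_unit (i + 3) *\<^sub>o oct_unit i = oct_unit (i + 1)"
    unfolding oct_unit_mult
    by (auto simp: oct_unit_def Finite_Cartesian_Product.vec_eq_iff oct_coeff_def axis_def fano_iff add.assoc)
qed


section \<open>Radial eigencubics\<close>

text \<open>
  Forms live on an arbitrary Euclidean space \<open>'a\<close>, whose standard orthonormal basis is
  \<open>Basis\<close>; so \<open>'a\<close> plays the role of n-dimensional space with n equal to \<open>DIM('a)\<close>.
\<close>

definition cubic_form :: "('a::euclidean_space \<Rightarrow> real) \<Rightarrow> bool" where
  "cubic_form f \<longleftrightarrow> real_polynomial_function f \<and> (\<forall>t x. f (t *\<^sub>R x) = t ^ 3 * f x)"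

definition partial :: "'a::euclidean_space \<Rightarrow> ('a \<Rightarrow> real) \<Rightarrow> 'a \<Rightarrow> real" where
  "partial i f x = frechet_derivative f (at x) i"

definition L_op :: "('a::euclidean_space \<Rightarrow> real) \<Rightarrow> 'a \<Rightarrow> real" where
  "L_op f x =
     (\<Sum>i\<in>Basis. (partial i f x)\<^sup>2) * (\<Sum>i\<in>Basis. partial i (partial i f) x)
     - (\<Sum>i\<in>Basis. \<Sum>j\<in>Basis. partial i f x * partial j f x * partial j (partial i f) x)"

definition radial_eigencubic :: "('a::euclidean_space \<Rightarrow> real) \<Rightarrow> bool" where
  "radial_eigencubic f \<longleftrightarrow>
     cubic_form f \<and> (\<exists>x. f x \<noteq> 0) \<and>
     (\<exists>lambda::real. lambda \<noteq> 0 \<and> (\<forall>x. L_op f x = lambda * (norm x)\<^sup>2 * f x))"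

definition congruent_forms ::
  "('a::euclidean_space \<Rightarrow> real) \<Rightarrow> ('a \<Rightarrow> real) \<Rightarrow> bool" where
  "congruent_forms f1 f2 \<longleftrightarrow>
     (\<exists>U c. orthogonal_transformation U \<and> c \<noteq> 0 \<and> (\<forall>x. f1 x = c * f2 (U x)))"


section \<open>Normal form and type\<close>

text \<open>The degrees refer to the three arguments separately.\<close>

definition trihomogeneous ::
  "nat \<Rightarrow> nat \<Rightarrow> nat \<Rightarrow> ('a::euclidean_space \<times> 'a \<times> 'a \<Rightarrow> real) \<Rightarrow> bool" where
  "trihomogeneous i j k psi \<longleftrightarrow>
     real_polynomial_function psi \<and>
     (\<forall>r s t \<xi> \<eta> \<zeta>.
        psi (r *\<^sub>R \<xi>, s *\<^sub>R \<eta>, t *\<^sub>R \<zeta>) = r ^ i * s ^ j * t ^ k * psi (\<xi>, \<eta>, \<zeta>))"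

definition orthogonal_sets :: "'a::real_inner set \<Rightarrow> 'a set \<Rightarrow> bool" where
  "orthogonal_sets S T \<longleftrightarrow> (\<forall>x\<in>S. \<forall>y\<in>T. x \<bullet> y = 0)"

definition orthogonal_decomposition ::
  "'a::euclidean_space \<Rightarrow> 'a set \<Rightarrow> 'a set \<Rightarrow> 'a set \<Rightarrow> bool" where
  "orthogonal_decomposition e V1 V2 V3 \<longleftrightarrow>
     norm e = 1 \<and> subspace V1 \<and> subspace V2 \<and> subspace V3 \<and>
     orthogonal_sets {e} V1 \<and> orthogonal_sets {e} V2 \<and> orthogonal_sets {e} V3 \<and>
     orthogonal_sets V1 V2 \<and> orthogonal_sets V1 V3 \<and> orthogonal_sets V2 V3 \<and>
     (\<forall>x. \<exists>t. \<exists>\<xi>\<in>V1. \<exists>\<eta>\<in>V2. \<exists>\<zeta>\<in>V3. x = t *\<^sub>R e + \<xi> + \<eta> + \<zeta>)"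

text \<open>
  The forms \<open>psi\<close> are taken on the whole space; only their restrictions to
  \<open>V1 \<times> V2 \<times> V3\<close> matter, and every form there extends, by composing it with the
  orthogonal projections.
\<close>

definition normal_form ::
  "('a::euclidean_space \<Rightarrow> real) \<Rightarrow> 'a \<Rightarrow> 'a set \<Rightarrow> 'a set \<Rightarrow> 'a set \<Rightarrow> bool" where
  "normal_form f e V1 V2 V3 \<longleftrightarrow>
     orthogonal_decomposition e V1 V2 V3 \<and>
     (\<exists>c psi111 psi102 psi012 psi030.
        c \<noteq> 0 \<and>
        trihomogeneous 1 1 1 psi111 \<and> trihomogeneous 1 0 2 psi102 \<and>
        trihomogeneous 0 1 2 psi012 \<and> trihomogeneous 0 3 0 psi030 \<and>
        (\<forall>t. \<forall>\<xi>\<in>V1. \<forall>\<eta>\<in>V2. \<forall>\<zeta>\<in>V3.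
           c * f (t *\<^sub>R e + \<xi> + \<eta> + \<zeta>) =
             t ^ 3 - 3 / 2 * t * (2 * (norm \<xi>)\<^sup>2 + (norm \<eta>)\<^sup>2 - (norm \<zeta>)\<^sup>2)
             + psi111 (\<xi>, \<eta>, \<zeta>) + psi102 (\<xi>, \<eta>, \<zeta>)
             + psi012 (\<xi>, \<eta>, \<zeta>) + psi030 (\<xi>, \<eta>, \<zeta>)))"

text \<open>
  The type of a radial eigencubic does not depend on the choice of the normal form, so being
  of type \<open>(n1, n2)\<close> means that some normal form has these dimensions.
\<close>

definition has_type :: "('a::euclidean_space \<Rightarrow> real) \<Rightarrow> nat \<times> nat \<Rightarrow> bool" where
  "has_type f n \<longleftrightarrow> (\<exists>e V1 V2 V3. normal_form f e V1 V2 V3 \<and> n = (dim V1, dim V2))"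


section \<open>Clifford systems and exceptional eigencubics\<close>

text \<open>
  The dimensions \<open>q + 1\<close> and \<open>2 * m\<close> are bound variables in the notion of an exceptional
  eigencubic, so they are not types: endomorphisms are matrices with explicit dimensions.
\<close>

definition clifford_system :: "nat \<Rightarrow> nat \<Rightarrow> (nat \<Rightarrow> real mat) \<Rightarrow> bool" where
  "clifford_system m q A \<longleftrightarrow>
     (\<forall>i\<le>q. A i \<in> carrier_mat (2 * m) (2 * m) \<and> transpose_mat (A i) = A i) \<and>
     (\<forall>i\<le>q. \<forall>j\<le>q.
        A i * A j + A j * A i = (if i = j then 2 else 0) \<cdot>\<^sub>m 1\<^sub>m (2 * m)) \<and>
     (q = 0 \<longrightarrow> (\<Sum>k<2 * m. A 0 $$ (k, k)) = 0)"

definition clifford_cubic ::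
  "nat \<Rightarrow> (nat \<Rightarrow> real mat) \<Rightarrow> real Matrix.vec \<Rightarrow> real Matrix.vec \<Rightarrow> real" where
  "clifford_cubic q A z y = (\<Sum>i\<le>q. scalar_prod y (A i *\<^sub>v y) * vec_index z i)"

text \<open>
  The same form on \<open>'a\<close>, where an enumeration \<open>b\<close> of \<open>Basis\<close> identifies \<open>'a\<close> with
  the product of the \<open>(q + 1)\<close>-dimensional \<open>z\<close>-space and the \<open>(2 * m)\<close>-dimensional
  \<open>y\<close>-space.
\<close>

definition clifford_cubic_on ::
  "(nat \<Rightarrow> 'a::euclidean_space) \<Rightarrow> nat \<Rightarrow> nat \<Rightarrow> (nat \<Rightarrow> real mat) \<Rightarrow> 'a \<Rightarrow> real" where
  "clifford_cubic_on b m q A x =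
     clifford_cubic q A
       (Matrix.vec (q + 1) (\<lambda>i. x \<bullet> b i))
       (Matrix.vec (2 * m) (\<lambda>j. x \<bullet> b (q + 1 + j)))"

definition exceptional :: "('a::euclidean_space \<Rightarrow> real) \<Rightarrow> bool" where
  "exceptional f \<longleftrightarrow>
     radial_eigencubic f \<and>
     \<not> (\<exists>m q A b. m \<ge> 1 \<and> (q + 1) + 2 * m = DIM('a) \<and> bij_betw b {..<DIM('a)} Basis \<and>
          clifford_system m q A \<and> congruent_forms f (clifford_cubic_on b m q A))"

end

theory Submission
  imports Defs "Jordan_Normal_Form.Char_Poly"
begin

text \<open>
  For imaginary octonions, \<open>f(u, v, w) = - u \<bullet> (v \<times> w)\<close> with the seven-dimensional cross product.
  It is trilinear, so its Laplacian vanishes, its gradient is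
  \<open>g = - (v \<times> w, w \<times> u, u \<times> v)\<close>, and \<open>w \<times> (w \<times> u) = (w \<bullet> u) w - (w \<bullet> w) u\<close> turns
  \<open>L f = - Hess f (g, g)\<close> into \<open>- 2 |x|\<^sup>2 f\<close>.

  To see that \<open>f\<close> is exceptional, compare the squared Frobenius norms of the Hessians. For \<open>f\<close> it is
  \<open>12 |x|\<^sup>2\<close>, for a Clifford cubic it is \<open>8 m |z|\<^sup>2 + 8 (q + 1) |y|\<^sup>2\<close>, so a congruence forces
  \<open>m = q + 1\<close>, hence \<open>m = 7\<close> and \<open>q = 6\<close>. But if \<open>q \<ge> 2\<close>, then \<open>A\<^sub>1 A\<^sub>2\<close> is a complex structure that
  commutes with \<open>A\<^sub>0\<close>, hence acts on its \<open>m\<close>-dimensional eigenspaces, and \<open>m\<close> is even.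

  For the type, let \<open>H\<close> be the quaternion subalgebra spanned by \<open>1, o\<^sub>7, o\<^sub>1, o\<^sub>3\<close> (the index
  7 is 0 in the type \<open>7\<close>) and take \<open>e = (o\<^sub>7, o\<^sub>1, o\<^sub>3) / \<surd>3\<close>. Besides the line of \<open>e\<close>,
  the eigenspaces of the Hessian at \<open>e\<close> are
  \<open>V\<^sub>1 = {(x, - o\<^sub>3 x, o\<^sub>1 x) | x orthogonal to H}\<close>, the space \<open>V\<^sub>2\<close> of traceless symmetric \<open>3 \<times> 3\<close> matrices
  over the basis \<open>o\<^sub>7, o\<^sub>1, o\<^sub>3\<close>, and the orthogonal complement \<open>V\<^sub>3\<close> of \<open>e\<close>, \<open>V\<^sub>1\<close> and \<open>V\<^sub>2\<close>.
\<close>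

(* Merging Defs with Char_Poly brings these back. *)
no_notation Matrix.scalar_prod (infix "\<bullet>" 70)
no_notation Matrix.vec_index (infixl "$" 100)

section \<open>The seven-dimensional cross product\<close>

lemma exhaust_7: "x = 0 \<or> x = 1 \<or> x = 2 \<or> x = 3 \<or> x = 4 \<or> x = 5 \<or> x = (6::7)"
proof (induct x)
  case (of_int z)
  then have "0 \<le> z" "z < 7" by simp_all
  then have "z = 0 \<or> z = 1 \<or> z = 2 \<or> z = 3 \<or> z = 4 \<or> z = 5 \<or> z = 6" by arith
  then show ?case by auto
qed

lemma UNIV_7: "(UNIV :: 7 set) = {0, 1, 2, 3, 4, 5, 6}"
  using exhaust_7 by auto

lemma sum_7: "sum h (UNIV :: 7 set) = h 0 + h 1 + h 2 + h 3 + h 4 + h 5 + h 6"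
  unfolding UNIV_7 by (simp add: add.assoc)

lemma numeral_7_reduce:
  "(7::7) = 0" "(8::7) = 1" "(9::7) = 2" "(10::7) = 3" "(11::7) = 4" "(12::7) = 5"
  by simp_all

lemma all_7: "(\<forall>i::7. P i) \<longleftrightarrow> P 0 \<and> P 1 \<and> P 2 \<and> P 3 \<and> P 4 \<and> P 5 \<and> P 6"
  by (metis exhaust_7)

definition oct_cross :: "real ^ 7 \<Rightarrow> real ^ 7 \<Rightarrow> real ^ 7" where
  "oct_cross v w = (\<chi> k. \<Sum>i\<in>UNIV. \<Sum>j\<in>UNIV. oct_coeff i j k * (v $ i) * (w $ j))"

text \<open>Solved for \<open>i\<close> and \<open>j\<close>: at a fixed output coordinate
  \<open>k\<close> only three pairs remain.\<close>

lemma fano_iff':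
  "fano i j k \<longleftrightarrow> j = k + 5 \<and> i = k + 4 \<or> j = k + 3 \<and> i = k + 1 \<or> j = k + 6 \<and> i = k + 2"
  unfolding fano_iff by (auto simp: add.assoc)

lemma oct_cross_nth:
  "oct_cross v w $ k = v $ (k + 4) * w $ (k + 5) - v $ (k + 5) * w $ (k + 4)
     + v $ (k + 1) * w $ (k + 3) - v $ (k + 3) * w $ (k + 1)
     + v $ (k + 2) * w $ (k + 6) - v $ (k + 6) * w $ (k + 2)"
proof -
  \<comment> \<open>The three cases exclude each other, so the indicator is a sum; the conditions
    are nested so that the double sums collapse.\<close>
  have F: "(if fano i j k then 1 else 0 :: real) =
     (if j = k + 5 then if i = k + 4 then 1 else 0 else 0) +
     (if j = k + 3 then if i = k + 1 then 1 else 0 else 0) +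
     (if j = k + 6 then if i = k + 2 then 1 else 0 else 0)" for i j
    unfolding fano_iff' by auto
  have C: "oct_coeff i j k = (if fano i j k then 1 else 0) - (if fano j i k then 1 else 0)" for i j
  proof -
    have "\<not> (fano i j k \<and> fano j i k)"
      by (auto simp: fano_iff add.assoc)
    then show ?thesis
      by (auto simp: oct_coeff_def)
  qed
  have G: "(\<Sum>i\<in>UNIV. \<Sum>j\<in>UNIV. (if j = b then if i = a then 1 else 0 else 0) * (x i * y j)) = x a * (y b :: real)"
    for x y and a b :: 7
  proof -
    have "(if j = b then if i = a then 1 else 0 else 0) * (x i * y j) =
        (if j = b then if i = a then x a * y b else 0 else 0)" for i j
      by simp
    then show ?thesis by simp
  qed
  have G': "(\<Sum>i\<in>UNIV. \<Sum>j\<in>UNIV. (if i = b then if j = a then 1 else 0 else 0) * (x i * y j)) = x b * (y a :: real)"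
    for x y and a b :: 7
  proof -
    have "(if i = b then if j = a then 1 else 0 else 0) * (x i * y j) =
        (if j = a then if i = b then x b * y a else 0 else 0)" for i j
      by simp
    then show ?thesis by simp
  qed
  show ?thesis
    unfolding oct_cross_def vec_lambda_beta C F
    by (simp add: left_diff_distrib distrib_right mult.assoc sum.distrib sum_subtractf G G')
qed

lemma oct_cross_nths:
  "oct_cross v w $ 0 = v$4 * w$5 - v$5 * w$4 + v$1 * w$3 - v$3 * w$1 + v$2 * w$6 - v$6 * w$2"
  "oct_cross v w $ 1 = v$5 * w$6 - v$6 * w$5 + v$2 * w$4 - v$4 * w$2 + v$3 * w$0 - v$0 * w$3"
  "oct_cross v w $ 2 = v$6 * w$0 - v$0 * w$6 + v$3 * w$5 - v$5 * w$3 + v$4 * w$1 - v$1 * w$4"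
  "oct_cross v w $ 3 = v$0 * w$1 - v$1 * w$0 + v$4 * w$6 - v$6 * w$4 + v$5 * w$2 - v$2 * w$5"
  "oct_cross v w $ 4 = v$1 * w$2 - v$2 * w$1 + v$5 * w$0 - v$0 * w$5 + v$6 * w$3 - v$3 * w$6"
  "oct_cross v w $ 5 = v$2 * w$3 - v$3 * w$2 + v$6 * w$1 - v$1 * w$6 + v$0 * w$4 - v$4 * w$0"
  "oct_cross v w $ 6 = v$3 * w$4 - v$4 * w$3 + v$0 * w$2 - v$2 * w$0 + v$1 * w$5 - v$5 * w$1"
  by (simp_all add: oct_cross_nth numeral_7_reduce)

lemma oct_cross_skew: "oct_cross v w = - oct_cross w v"
  by (simp add: Finite_Cartesian_Product.vec_eq_iff oct_cross_nth)

lemma bilinear_oct_cross: "bilinear oct_cross"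
  by (auto simp: bilinear_def linear_iff Finite_Cartesian_Product.vec_eq_iff oct_cross_nth algebra_simps)

text \<open>This is the alternative law \<open>w (w u) = (w w) u\<close> for imaginary octonions. In
  coordinates it is a polynomial identity.\<close>

lemma oct_cross_cross:
  "oct_cross w (oct_cross w u) = (w \<bullet> u) *\<^sub>R w - (w \<bullet> w) *\<^sub>R u"
  unfolding Finite_Cartesian_Product.vec_eq_iff all_7
  by (intro conjI; simp add: oct_cross_nths inner_vec_def sum_7 algebra_simps)

section \<open>The alternating triple product and its identities\<close>

definition oct_triple :: "real ^ 7 \<Rightarrow> real ^ 7 \<Rightarrow> real ^ 7 \<Rightarrow> real" where
  "oct_triple u v w = u \<bullet> oct_cross v w"

lemma oct_triple_cyclic: "oct_triple u v w = oct_triple v w u"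
  by (simp add: oct_triple_def inner_vec_def sum_7 oct_cross_nths algebra_simps)

lemma oct_triple_add:
  "oct_triple (u + u') v w = oct_triple u v w + oct_triple u' v w"
  "oct_triple u (v + v') w = oct_triple u v w + oct_triple u v' w"
  "oct_triple u v (w + w') = oct_triple u v w + oct_triple u v w'"
  using bilinear_oct_cross
  by (simp_all add: oct_triple_def inner_add bilinear_ladd bilinear_radd)

lemma oct_triple_scaleR:
  "oct_triple (r *\<^sub>R u) v w = r * oct_triple u v w"
  "oct_triple u (r *\<^sub>R v) w = r * oct_triple u v w"
  "oct_triple u v (r *\<^sub>R w) = r * oct_triple u v w"
  using bilinear_oct_cross
  by (simp_all add: oct_triple_def bilinear_lmul bilinear_rmul)

lemma oct_triple_zero [simp]:
  "oct_triple 0 v w = 0" "oct_triple u 0 w = 0" "oct_triple u v 0 = 0"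
  using oct_triple_scaleR(1)[of 0] oct_triple_scaleR(2)[of _ 0] oct_triple_scaleR(3)[of _ _ 0]
  by simp_all

lemma oct_triple_swap: "oct_triple u v w = - oct_triple u w v"
  using oct_cross_skew[of v w] by (simp add: oct_triple_def)

text \<open>The real part of a product with an imaginary left factor is minus the inner product of
  the imaginary parts, and the imaginary part of \<open>o_v o_w\<close> is
  \<open>oct_cross v w\<close>.\<close>

lemma oct_re_mult_imaginary:
  "oct_re (oct_of u *\<^sub>o (oct_of v *\<^sub>o oct_of w)) = - oct_triple u v w"
proof -
  have "oct_of u = (0, u)" for u
    by (auto simp: oct_of_def oct_unit_def prod_eq_iff fst_sum snd_sum Finite_Cartesian_Product.vec_eq_iff axis_def if_distrib cong: if_cong)
  then show ?thesis
    by (simp add: oct_re_def oct_mult_def oct_triple_def flip: oct_cross_def)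
qed

text \<open>Cyclicity moves one factor across the inner product, and a double cross product with a
  repeated factor appears.\<close>

lemma norm_oct_cross: "(norm (oct_cross v w))\<^sup>2 = (v \<bullet> v) * (w \<bullet> w) - (v \<bullet> w)\<^sup>2"
proof -
  have "(norm (oct_cross v w))\<^sup>2 = oct_triple (oct_cross v w) v w"
    by (simp add: power2_norm_eq_inner oct_triple_def)
  also have "\<dots> = v \<bullet> oct_cross w (oct_cross v w)"
    by (subst oct_triple_cyclic) (simp add: oct_triple_def)
  also have "\<dots> = - (v \<bullet> oct_cross w (oct_cross w v))"
    by (subst oct_cross_skew) (use bilinear_oct_cross in \<open>simp add: bilinear_rneg\<close>)
  finally show ?thesis
    by (simp add: oct_cross_cross inner_diff_right power2_eq_square inner_commute)
qed

text \<open>Evaluates one term of the Hessian on the gradient. Skewness produces a double cross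
  product; its surplus term has a repeated argument and vanishes.\<close>

lemma oct_triple_cross:
  "oct_triple (oct_cross v w) (oct_cross w u) w = (w \<bullet> w) * oct_triple u v w"
proof -
  have "oct_triple (oct_cross v w) (oct_cross w u) w = - (oct_cross v w \<bullet> oct_cross w (oct_cross w u))"
    using oct_cross_skew[of "oct_cross w u" w] by (simp add: oct_triple_def)
  also have "\<dots> = (w \<bullet> w) * oct_triple u v w - (w \<bullet> u) * oct_triple w v w"
    by (simp add: oct_cross_cross inner_diff_right oct_triple_def inner_commute)
  also have "oct_triple w v w = 0"
    using oct_triple_swap[of v w w] by (simp add: oct_triple_cyclic[of w v w])
  finally show ?thesis by simp
qed

section \<open>The eigencubic equation\<close>

type_synonym oct3 = "(real ^ 7) \<times> (real ^ 7) \<times> (real ^ 7)"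

lemma has_derivative_oct_triple:
  assumes "(f has_derivative f') (at x)" "(g has_derivative g') (at x)" "(h has_derivative h') (at x)"
  shows "((\<lambda>x. oct_triple (f x) (g x) (h x)) has_derivative
    (\<lambda>d. oct_triple (f' d) (g x) (h x) + oct_triple (f x) (g' d) (h x) + oct_triple (f x) (g x) (h' d))) (at x)"
proof -
  have "bounded_bilinear oct_cross"
    using bilinear_oct_cross by (simp add: bilinear_conv_bounded_bilinear)
  from has_derivative_inner[OF assms(1) bounded_bilinear.FDERIV[OF this assms(2,3)]]
  show ?thesis
    unfolding oct_triple_def by (rule has_derivative_eq_rhs) (auto simp: inner_add_right)
qed

lemma real_polynomial_function_oct_triple:
  assumes "linear p" "linear q" "linear (r :: 'a::euclidean_space \<Rightarrow> _)"
  shows "real_polynomial_function (\<lambda>x. oct_triple (p x) (q x) (r x))"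
proof -
  have "real_polynomial_function (\<lambda>x. l x $ i)" if "linear (l :: 'a \<Rightarrow> real ^ 7)" for l i
    using that by (intro real_polynomial_function.intros(1) bounded_linear_vec_nth[THEN bounded_linear_compose])
      (simp add: linear_conv_bounded_linear)
  then show ?thesis
    using assms unfolding oct_triple_def inner_vec_def oct_cross_def vec_lambda_beta inner_real_def
    by (intro real_polynomial_function_sum real_polynomial_function.intros(2,4) finite_class.finite_UNIV) auto
qed

definition oct_cubic :: "oct3 \<Rightarrow> real" where
  "oct_cubic x = - oct_triple (fst x) (fst (snd x)) (snd (snd x))"

definition oct_cubic_grad :: "oct3 \<Rightarrow> oct3" where
  "oct_cubic_grad x = (- oct_cross (fst (snd x)) (snd (snd x)),
     - oct_cross (snd (snd x)) (fst x), - oct_cross (fst x) (fst (snd x)))"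

text \<open>The Hessian at \<open>x\<close> applied to \<open>y\<close> and \<open>z\<close>. For a
  cubic form this is also the full polarization, hence symmetric in all three arguments.\<close>

definition oct_cubic_hess :: "oct3 \<Rightarrow> oct3 \<Rightarrow> oct3 \<Rightarrow> real" where
  "oct_cubic_hess x y z = - (
     oct_triple (fst x) (fst (snd y)) (snd (snd z)) + oct_triple (fst x) (fst (snd z)) (snd (snd y)) +
     oct_triple (fst y) (fst (snd x)) (snd (snd z)) + oct_triple (fst z) (fst (snd x)) (snd (snd y)) +
     oct_triple (fst y) (fst (snd z)) (snd (snd x)) + oct_triple (fst z) (fst (snd y)) (snd (snd x)))"

text \<open>Isolates each argument in an inner product, which exhibits the components of the
  gradient.\<close>

lemma oct_triple_alt:
  "oct_triple u v w = oct_cross v w \<bullet> u"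
  "oct_triple u v w = oct_cross w u \<bullet> v"
  "oct_triple u v w = oct_cross u v \<bullet> w"
  using oct_triple_cyclic[of u v w] oct_triple_cyclic[of v w u]
  by (simp_all add: oct_triple_def inner_commute)

lemma partial_oct_cubic: "partial i oct_cubic x = oct_cubic_grad x \<bullet> i"
proof -
  have "(oct_cubic has_derivative (\<lambda>i. oct_cubic_grad x \<bullet> i)) (at x)"
    unfolding oct_cubic_def
  proof (rule has_derivative_eq_rhs, (rule derivative_intros has_derivative_oct_triple)+, rule ext)
    fix i
    show "- (oct_triple (fst i) (fst (snd x)) (snd (snd x)) + oct_triple (fst x) (fst (snd i)) (snd (snd x))
       + oct_triple (fst x) (fst (snd x)) (snd (snd i))) = oct_cubic_grad x \<bullet> i"
      using oct_triple_alt(1)[of "fst i"] oct_triple_alt(2)[of "fst x" "fst (snd i)"]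
        oct_triple_alt(3)[of "fst x" "fst (snd x)" "snd (snd i)"]
      by (simp add: oct_cubic_grad_def inner_prod_def)
  qed
  then show ?thesis
    unfolding partial_def by (subst frechet_derivative_at[symmetric]) auto
qed

lemma partial_partial_oct_cubic:
  "partial j (partial i oct_cubic) x = oct_cubic_hess x i j"
proof -
  \<comment> \<open>Back in terms of triple products, the partial derivative can be differentiated
    by the same rule once more.\<close>
  have E: "partial i oct_cubic = (\<lambda>x. - (oct_triple (fst i) (fst (snd x)) (snd (snd x))
     + oct_triple (fst x) (fst (snd i)) (snd (snd x)) + oct_triple (fst x) (fst (snd x)) (snd (snd i))))"
    using oct_triple_alt(1)[of "fst i"] oct_triple_alt(2)[of _ "fst (snd i)"]
      oct_triple_alt(3)[of _ _ "snd (snd i)"]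
    by (simp add: fun_eq_iff partial_oct_cubic oct_cubic_grad_def inner_prod_def)
  have "(partial i oct_cubic has_derivative oct_cubic_hess x i) (at x)"
    unfolding E
    by (rule has_derivative_eq_rhs, (rule derivative_intros has_derivative_oct_triple)+)
      (auto simp: fun_eq_iff oct_cubic_hess_def)
  then show ?thesis
    unfolding partial_def by (subst frechet_derivative_at[symmetric]) auto
qed

lemma bilinear_oct_cubic_hess: "bilinear (oct_cubic_hess x)"
  by (auto simp: bilinear_def linear_iff oct_cubic_hess_def oct_triple_add oct_triple_scaleR algebra_simps)

lemma sum_Basis_bilinear:
  fixes B :: "'a::euclidean_space \<Rightarrow> 'a \<Rightarrow> real"
  assumes "bilinear B"
  shows "(\<Sum>i\<in>Basis. \<Sum>j\<in>Basis. (g \<bullet> i) * (g \<bullet> j) * B i j) = B g g"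
proof -
  have "B g g = B (\<Sum>i\<in>Basis. (g \<bullet> i) *\<^sub>R i) (\<Sum>i\<in>Basis. (g \<bullet> i) *\<^sub>R i)"
    by (simp add: euclidean_representation)
  also have "\<dots> = (\<Sum>i\<in>Basis. \<Sum>j\<in>Basis. (g \<bullet> i) * (g \<bullet> j) * B i j)"
    using assms
    by (subst bilinear_sum[OF assms]) (auto simp: sum.cartesian_product bilinear_lmul bilinear_rmul mult_ac)
  finally show ?thesis by simp
qed

text \<open>A basis vector lies in one of the three factors, while every term of the Hessian pairs
  two different factors. So the Laplacian vanishes.\<close>

lemma oct_cubic_hess_Basis: "i \<in> Basis \<Longrightarrow> oct_cubic_hess x i i = 0"
  by (auto simp: Basis_prod_def oct_cubic_hess_def)

text \<open>The six terms agree in pairs. The remaining three are cyclic images of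
  \<open>oct_triple_cross\<close> and contribute the squared norms of \<open>u\<close>,
  \<open>v\<close> and \<open>w\<close>.\<close>

lemma oct_cubic_hess_grad:
  "oct_cubic_hess x (oct_cubic_grad x) (oct_cubic_grad x) = 2 * (norm x)\<^sup>2 * oct_cubic x"
proof -
  obtain u v w where x: "x = (u, v, w)" by (cases x)
  have neg: "oct_triple (- a) b c = - oct_triple a b c" "oct_triple a (- b) c = - oct_triple a b c"
      "oct_triple a b (- c) = - oct_triple a b c" for a b c
    using oct_triple_scaleR(1)[of "-1"] oct_triple_scaleR(2)[of _ "-1"] oct_triple_scaleR(3)[of _ _ "-1"] by simp_all
  have "oct_triple (oct_cross v w) v (oct_cross u v) = (v \<bullet> v) * oct_triple u v w"
    by (metis oct_triple_cross oct_triple_cyclic)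
  moreover have "oct_triple u (oct_cross w u) (oct_cross u v) = (u \<bullet> u) * oct_triple u v w"
    by (metis oct_triple_cross oct_triple_cyclic)
  ultimately show ?thesis
    unfolding x oct_cubic_hess_def oct_cubic_grad_def oct_cubic_def fst_conv snd_conv neg
    by (simp add: oct_triple_cross norm_Pair power2_norm_eq_inner algebra_simps)
qed

lemma radial_eigencubic_oct_cubic: "radial_eigencubic oct_cubic"
proof -
  have lin: "linear (\<lambda>x::oct3. fst x)" "linear (\<lambda>x::oct3. fst (snd x))" "linear (\<lambda>x::oct3. snd (snd x))"
    by (simp_all add: linear_iff)
  have "cubic_form oct_cubic"
    unfolding cubic_form_def oct_cubic_def
    by (auto intro!: real_polynomial_function_oct_triple lin real_polynomial_function_minus
        simp: oct_triple_scaleR power3_eq_cube)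
  \<comment> \<open>Since \<open>o_1 o_3 = o_7\<close>, the value at this point is -1.\<close>
  moreover have "oct_cubic (axis 0 1, axis 1 1, axis 3 1) \<noteq> 0"
    by (simp add: oct_cubic_def oct_triple_def inner_axis' oct_cross_nths) (simp add: axis_def)
  moreover have "L_op oct_cubic x = - 2 * (norm x)\<^sup>2 * oct_cubic x" for x
    by (simp add: L_op_def partial_partial_oct_cubic partial_oct_cubic oct_cubic_hess_Basis
      sum_Basis_bilinear[OF bilinear_oct_cubic_hess] oct_cubic_hess_grad)
  ultimately show ?thesis
    unfolding radial_eigencubic_def by (intro conjI exI[of _ "-2"]) auto
qed

section \<open>The normal form\<close>

definition vec7 :: "real \<Rightarrow> real \<Rightarrow> real \<Rightarrow> real \<Rightarrow> real \<Rightarrow> real \<Rightarrow> real \<Rightarrow> real ^ 7" where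
  "vec7 a b c d e f g = (\<chi> i. if i = 0 then a else if i = 1 then b else if i = 2 then c
     else if i = 3 then d else if i = 4 then e else if i = 5 then f else g)"

lemma vec7_nth [simp]:
  "vec7 a b c d e f g $ 0 = a" "vec7 a b c d e f g $ 1 = b" "vec7 a b c d e f g $ 2 = c"
  "vec7 a b c d e f g $ 3 = d" "vec7 a b c d e f g $ 4 = e" "vec7 a b c d e f g $ 5 = f"
  "vec7 a b c d e f g $ 6 = g"
  by (simp_all add: vec7_def)

lemma vec7_eq_iff: "(x :: real ^ 7) = y \<longleftrightarrow> x $ 0 = y $ 0 \<and> x $ 1 = y $ 1 \<and> x $ 2 = y $ 2 \<and>
    x $ 3 = y $ 3 \<and> x $ 4 = y $ 4 \<and> x $ 5 = y $ 5 \<and> x $ 6 = y $ 6"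
  unfolding Finite_Cartesian_Product.vec_eq_iff all_7 ..

text \<open>
  This is \<open>(o\<^sub>7, o\<^sub>1, o\<^sub>3)\<close>, of length \<open>\<surd>3\<close>; it is left unnormalized to keep coordinates rational.
\<close>

definition nf_e :: oct3 where
  "nf_e = (vec7 1 0 0 0 0 0 0, vec7 0 1 0 0 0 0 0, vec7 0 0 0 1 0 0 0)"

text \<open>The triple \<open>(x, - o_3 x, o_1 x)\<close> written out, for \<open>x\<close> with
  coordinates \<open>a, b, c, d\<close> on \<open>o_2, o_4, o_5, o_6\<close>.\<close>

definition nf_1 :: "real \<times> real \<times> real \<times> real \<Rightarrow> oct3" where
  "nf_1 = (\<lambda>(a, b, c, d).
     (vec7 0 0 a 0 b c d, vec7 0 0 (- c) 0 d a (- b), vec7 0 0 (- b) 0 a (- d) c))"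

text \<open>The rows of the traceless symmetric matrix sit at the coordinates 0, 1, 3 of the three
  vectors.\<close>

definition nf_2 :: "real \<times> real \<times> real \<times> real \<times> real \<Rightarrow> oct3" where
  "nf_2 = (\<lambda>(a, b, c, d, e).
     (vec7 a c 0 d 0 0 0, vec7 c b 0 e 0 0 0, vec7 d e 0 (- a - b) 0 0 0))"

text \<open>
  The parameters are a skew-symmetric matrix over the basis \<open>o\<^sub>7, o\<^sub>1, o\<^sub>3\<close> and a triple
  \<open>(p, q, r)\<close> of vectors orthogonal to the quaternion subalgebra with \<open>p = o\<^sub>1 r - o\<^sub>3 q\<close>, which is
  orthogonality to the range of \<open>nf_1\<close>.
\<close>

definition nf_3 :: "(real \<times> real \<times> real) \<times> (real \<times> real \<times> real \<times> real) \<times> (real \<times> real \<times> real \<times> real) \<Rightarrow> oct3" where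
  "nf_3 = (\<lambda>((k1, k2, k3), (q2, q4, q5, q6), (r2, r4, r5, r6)).
     (vec7 0 k1 (- r4 - q5) k2 (r2 + q6) (q2 - r6) (r5 - q4),
      vec7 (- k1) 0 q2 k3 q4 q5 q6, vec7 (- k2) (- k3) r2 0 r4 r5 r6))"

lemma linear_nf: "linear nf_1" "linear nf_2" "linear nf_3"
  by (auto simp: linear_iff nf_1_def nf_2_def nf_3_def vec7_eq_iff algebra_simps)

lemma oct3_exhaust:
  obtains u0 u1 u2 u3 u4 u5 u6 v0 v1 v2 v3 v4 v5 v6 w0 w1 w2 w3 w4 w5 w6 where
  "x = (vec7 u0 u1 u2 u3 u4 u5 u6, vec7 v0 v1 v2 v3 v4 v5 v6, vec7 w0 w1 w2 w3 w4 w5 w6)"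
proof -
  have "u = vec7 (u $ 0) (u $ 1) (u $ 2) (u $ 3) (u $ 4) (u $ 5) (u $ 6)" for u
    by (simp add: vec7_eq_iff)
  then show ?thesis
    using that by (metis surj_pair)
qed

lemma vec7_algebra:
  "vec7 a b c d e f g + vec7 a' b' c' d' e' f' g' =
    vec7 (a + a') (b + b') (c + c') (d + d') (e + e') (f + f') (g + g')"
  "r *\<^sub>R vec7 a b c d e f g = vec7 (r * a) (r * b) (r * c) (r * d) (r * e) (r * f) (r * g)"
  "vec7 a b c d e f g \<bullet> vec7 a' b' c' d' e' f' g' =
    a * a' + b * b' + c * c' + d * d' + e * e' + f * f' + g * g'"
  by (simp_all add: vec7_eq_iff inner_vec_def sum_7)

lemma nf_spanning: "\<exists>t p1 p2 p3. x = t *\<^sub>R nf_e + nf_1 p1 + nf_2 p2 + nf_3 p3"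
proof (cases x rule: oct3_exhaust)
  case (1 u0 u1 u2 u3 u4 u5 u6 v0 v1 v2 v3 v4 v5 v6 w0 w1 w2 w3 w4 w5 w6)
  \<comment> \<open>Orthogonal projections: inner products with \<open>nf_e\<close> and with the
    images under \<open>nf_1\<close> of the unit vectors, all of squared length 3. The quaternionic
    block then splits into symmetric and skew parts.\<close>
  define t where "t = (u0 + v1 + w3) / 3"
  define a b c d where "a = (u2 + v5 + w4) / 3" and "b = (u4 - v6 - w2) / 3"
    and "c = (u5 - v2 + w6) / 3" and "d = (u6 + v4 - w5) / 3"
  have "x = t *\<^sub>R nf_e + nf_1 (a, b, c, d) +
      nf_2 (u0 - t, v1 - t, (u1 + v0) / 2, (u3 + w0) / 2, (v3 + w1) / 2) +
      nf_3 (((u1 - v0) / 2, (u3 - w0) / 2, (v3 - w1) / 2),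
        (v2 + c, v4 - d, v5 - a, v6 + b), (w2 + b, w4 - a, w5 + d, w6 - c))"
    unfolding 1 nf_e_def nf_1_def nf_2_def nf_3_def prod.case vec7_algebra add_Pair scaleR_Pair
      t_def a_def b_def c_def d_def
    by (simp add: field_simps)
  then show ?thesis by blast
qed

lemma nf_orthogonal:
  "nf_e \<bullet> nf_1 p1 = 0" "nf_e \<bullet> nf_2 p2 = 0" "nf_e \<bullet> nf_3 p3 = 0"
  "nf_1 p1 \<bullet> nf_2 p2 = 0" "nf_1 p1 \<bullet> nf_3 p3 = 0" "nf_2 p2 \<bullet> nf_3 p3 = 0"
  by (cases p1; cases p2; cases p3; simp add: nf_e_def nf_1_def nf_2_def nf_3_def split_beta vec7_algebra inner_Pair algebra_simps)+

section \<open>The coefficients of the cubic along the decomposition\<close>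

lemmas nf_eval = oct_cubic_hess_def oct_cubic_def oct_triple_def nf_e_def nf_1_def nf_2_def nf_3_def
  inner_vec_def sum_7 oct_cross_nths split_beta fst_conv snd_conv vec7_nth

text \<open>The first three equations make the gradient at \<open>nf_e\<close> a multiple of
  \<open>nf_e\<close>; the others say that the Hessian there does not mix the three spaces.\<close>

lemma hess_nf_e:
  "oct_cubic_hess nf_e nf_e (nf_1 p1) = 0"
  "oct_cubic_hess nf_e nf_e (nf_2 p2) = 0"
  "oct_cubic_hess nf_e nf_e (nf_3 p3) = 0"
  "oct_cubic_hess nf_e (nf_1 p1) (nf_2 p2) = 0"
  "oct_cubic_hess nf_e (nf_1 p1) (nf_3 p3) = 0"
  "oct_cubic_hess nf_e (nf_2 p2) (nf_3 p3) = 0"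
  by (simp_all add: nf_eval algebra_simps)

text \<open>The eigenvalues 2, 1, -1 are the weights of the three squared norms in the normal
  form.\<close>

lemma hess_nf_e_quadratic:
  "oct_cubic_hess nf_e (nf_1 p1) (nf_1 p1) = 2 * (norm (nf_1 p1))\<^sup>2"
  "oct_cubic_hess nf_e (nf_2 p2) (nf_2 p2) = (norm (nf_2 p2))\<^sup>2"
  "oct_cubic_hess nf_e (nf_3 p3) (nf_3 p3) = - (norm (nf_3 p3))\<^sup>2"
  by (simp_all add: nf_eval power2_norm_eq_inner inner_prod_def algebra_simps)

text \<open>Here and in the next two lemmas, exactly the components of degrees 300, 210, 201, 120,
  021 and 003 are shown to vanish, which the normal form excludes.\<close>

lemma hess_nf_1: "oct_cubic_hess (nf_1 p1) (nf_1 p1) (nf_1 p1) = 0"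
  "oct_cubic_hess (nf_1 p1) (nf_1 p1) (nf_2 p2) = 0"
  "oct_cubic_hess (nf_1 p1) (nf_1 p1) (nf_3 p3) = 0"
  by (simp_all add: nf_eval algebra_simps)

lemma hess_nf_2:
  "oct_cubic_hess (nf_1 p1) (nf_2 p2) (nf_2 p2) = 0"
  "oct_cubic_hess (nf_2 p2) (nf_2 p2) (nf_3 p3) = 0"
  by (simp_all add: nf_eval algebra_simps)

lemma hess_nf_3: "oct_cubic_hess (nf_3 p3) (nf_3 p3) (nf_3 p3) = 0"
  by (simp add: nf_eval algebra_simps)

lemma real_polynomial_function_oct_cubic_hess:
  assumes "linear p" "linear q" "linear (r :: 'a::euclidean_space \<Rightarrow> _)"
  shows "real_polynomial_function (\<lambda>x. oct_cubic_hess (p x) (q x) (r x))"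
proof -
  have "linear (\<lambda>x. fst (l x))" "linear (\<lambda>x. fst (snd (l x)))" "linear (\<lambda>x. snd (snd (l x)))"
    if "linear l" for l :: "'a \<Rightarrow> oct3"
    using that by (simp_all add: linear_iff)
  with assms show ?thesis
    unfolding oct_cubic_hess_def
    by (intro real_polynomial_function_minus real_polynomial_function.intros(3)
      real_polynomial_function_oct_triple) auto
qed

lemma oct_cubic_hess_add:
  "oct_cubic_hess (x + x') y z = oct_cubic_hess x y z + oct_cubic_hess x' y z"
  "oct_cubic_hess x (y + y') z = oct_cubic_hess x y z + oct_cubic_hess x y' z"
  "oct_cubic_hess x y (z + z') = oct_cubic_hess x y z + oct_cubic_hess x y z'"
  by (simp_all add: oct_cubic_hess_def oct_triple_add)

lemma oct_cubic_hess_scaleR: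
  "oct_cubic_hess (r *\<^sub>R x) y z = r * oct_cubic_hess x y z"
  "oct_cubic_hess x (r *\<^sub>R y) z = r * oct_cubic_hess x y z"
  "oct_cubic_hess x y (r *\<^sub>R z) = r * oct_cubic_hess x y z"
  by (simp_all add: oct_cubic_hess_def oct_triple_scaleR algebra_simps)

lemma oct_cubic_hess_commute:
  "oct_cubic_hess x y z = oct_cubic_hess y x z"
  "oct_cubic_hess x y z = oct_cubic_hess x z y"
  by (simp_all add: oct_cubic_hess_def)

lemma oct_cubic_eq_hess: "oct_cubic x = oct_cubic_hess x x x / 6"
  by (simp add: oct_cubic_def oct_cubic_hess_def)

text \<open>Multinomial expansion of the polarization: of its twenty coefficients, only those of the
  normal form survive.\<close>

lemma oct_cubic_nf:
  "oct_cubic (s *\<^sub>R nf_e + nf_1 p1 + nf_2 p2 + nf_3 p3) =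
     - (s ^ 3) + s / 2 * (2 * (norm (nf_1 p1))\<^sup>2 + (norm (nf_2 p2))\<^sup>2 - (norm (nf_3 p3))\<^sup>2)
     + oct_cubic_hess (nf_1 p1) (nf_2 p2) (nf_3 p3) + oct_cubic_hess (nf_1 p1) (nf_3 p3) (nf_3 p3) / 2
     + oct_cubic_hess (nf_2 p2) (nf_3 p3) (nf_3 p3) / 2 + oct_cubic (nf_2 p2)"
proof -
  have eee: "oct_cubic_hess nf_e nf_e nf_e = - 6"
    by (simp add: nf_eval)
  note z = eee hess_nf_e hess_nf_e_quadratic hess_nf_1 hess_nf_2 hess_nf_3
  define H where "H = oct_cubic_hess"
  have add: "6 * oct_cubic (e + x + y + z) = H e e e + H x x x + H y y y + H z z z +
      3 * (H e e x + H e e y + H e e z + H e x x + H e y y + H e z z + H x x y + H x x z + H x y y + H y y z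
        + H x z z + H y z z) +
      6 * (H e x y + H e x z + H e y z + H x y z)" for e x y z
    by (simp add: oct_cubic_eq_hess oct_cubic_hess_add oct_cubic_hess_commute H_def)
  show ?thesis
    using add[of "s *\<^sub>R nf_e" "nf_1 p1" "nf_2 p2" "nf_3 p3"] oct_cubic_eq_hess[of "nf_2 p2"]
    by (simp add: H_def oct_cubic_hess_scaleR z power3_eq_cube algebra_simps)
qed

lemma trihomogeneous_oct_cubic_hess:
  "trihomogeneous 1 1 1 (\<lambda>(\<xi>, \<eta>, \<zeta>). k * oct_cubic_hess \<xi> \<eta> \<zeta>)"
  "trihomogeneous 1 0 2 (\<lambda>(\<xi>, \<eta>, \<zeta>). k * oct_cubic_hess \<xi> \<zeta> \<zeta>)"
  "trihomogeneous 0 1 2 (\<lambda>(\<xi>, \<eta>, \<zeta>). k * oct_cubic_hess \<eta> \<zeta> \<zeta>)"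
  "trihomogeneous 0 3 0 (\<lambda>(\<xi>, \<eta>, \<zeta>). k * oct_cubic_hess \<eta> \<eta> \<eta>)"
proof -
  have lin: "linear (fst :: oct3 \<times> oct3 \<times> oct3 \<Rightarrow> _)" "linear (\<lambda>x :: oct3 \<times> oct3 \<times> oct3. fst (snd x))"
    "linear (\<lambda>x :: oct3 \<times> oct3 \<times> oct3. snd (snd x))"
    by (simp_all add: linear_iff)
  note poly = real_polynomial_function.intros(4)[OF real_polynomial_function.intros(2)
      real_polynomial_function_oct_cubic_hess]
  show "trihomogeneous 1 1 1 (\<lambda>(\<xi>, \<eta>, \<zeta>). k * oct_cubic_hess \<xi> \<eta> \<zeta>)"
    "trihomogeneous 1 0 2 (\<lambda>(\<xi>, \<eta>, \<zeta>). k * oct_cubic_hess \<xi> \<zeta> \<zeta>)"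
    "trihomogeneous 0 1 2 (\<lambda>(\<xi>, \<eta>, \<zeta>). k * oct_cubic_hess \<eta> \<zeta> \<zeta>)"
    "trihomogeneous 0 3 0 (\<lambda>(\<xi>, \<eta>, \<zeta>). k * oct_cubic_hess \<eta> \<eta> \<eta>)"
    unfolding trihomogeneous_def split_beta
    by (auto intro!: poly lin simp: oct_cubic_hess_scaleR power2_eq_square power3_eq_cube)
qed

lemma has_type_oct_cubic: "has_type oct_cubic (4, 5)"
proof -
  define e where "e = (1 / sqrt 3) *\<^sub>R nf_e"
  have ne: "norm e = 1"
    by (simp add: e_def norm_eq_sqrt_inner nf_e_def inner_Pair vec7_algebra)
  have decomp: "orthogonal_decomposition e (range nf_1) (range nf_2) (range nf_3)"
    unfolding orthogonal_decomposition_def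
  proof (intro conjI allI)
    fix x
    obtain t p1 p2 p3 where "x = t *\<^sub>R nf_e + nf_1 p1 + nf_2 p2 + nf_3 p3"
      using nf_spanning by blast
    then have "x = (t * sqrt 3) *\<^sub>R e + nf_1 p1 + nf_2 p2 + nf_3 p3"
      by (simp add: e_def)
    then show "\<exists>t. \<exists>\<xi>\<in>range nf_1. \<exists>\<eta>\<in>range nf_2. \<exists>\<zeta>\<in>range nf_3. x = t *\<^sub>R e + \<xi> + \<eta> + \<zeta>"
      by blast
  qed (use ne in \<open>auto simp: orthogonal_sets_def nf_orthogonal e_def
      intro!: linear_subspace_image linear_nf\<close>)
  \<comment> \<open>The inverse of \<open>oct_cubic e\<close>, since \<open>oct_cubic nf_e\<close>
    is -1 and \<open>nf_e\<close> has length \<open>sqrt 3\<close>; this makes the coefficient of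
    \<open>t ^ 3\<close> equal to 1.\<close>
  let ?c = "- 3 * sqrt 3"
  have "normal_form oct_cubic e (range nf_1) (range nf_2) (range nf_3)"
    unfolding normal_form_def
  proof (intro conjI exI ballI allI)
    show "orthogonal_decomposition e (range nf_1) (range nf_2) (range nf_3)" by fact
    show "?c \<noteq> 0" by simp
    fix t \<xi> \<eta> \<zeta> assume "\<xi> \<in> range nf_1" "\<eta> \<in> range nf_2" "\<zeta> \<in> range nf_3"
    then obtain p1 p2 p3 where p: "\<xi> = nf_1 p1" "\<eta> = nf_2 p2" "\<zeta> = nf_3 p3" by blast
    have "t *\<^sub>R e = (t / sqrt 3) *\<^sub>R nf_e"
      by (simp add: e_def)
    moreover have "?c * - ((t / sqrt 3) ^ 3) = t ^ 3"
      by (simp add: power3_eq_cube field_simps)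
    moreover have "?c * (t / sqrt 3 / 2 * N) = - (3 / 2 * t * N)" for N
      by (simp add: field_simps)
    \<comment> \<open>The four abstractions instantiate the forms \<open>psi\<close> left open by
      \<open>exI\<close>, in the shape of \<open>trihomogeneous_oct_cubic_hess\<close>.\<close>
    ultimately show "?c * oct_cubic (t *\<^sub>R e + \<xi> + \<eta> + \<zeta>) =
      t ^ 3 - 3 / 2 * t * (2 * (norm \<xi>)\<^sup>2 + (norm \<eta>)\<^sup>2 - (norm \<zeta>)\<^sup>2) +
      (\<lambda>(\<xi>, \<eta>, \<zeta>). ?c * oct_cubic_hess \<xi> \<eta> \<zeta>) (\<xi>, \<eta>, \<zeta>) +
      (\<lambda>(\<xi>, \<eta>, \<zeta>). ?c / 2 * oct_cubic_hess \<xi> \<zeta> \<zeta>) (\<xi>, \<eta>, \<zeta>) +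
      (\<lambda>(\<xi>, \<eta>, \<zeta>). ?c / 2 * oct_cubic_hess \<eta> \<zeta> \<zeta>) (\<xi>, \<eta>, \<zeta>) +
      (\<lambda>(\<xi>, \<eta>, \<zeta>). ?c / 6 * oct_cubic_hess \<eta> \<eta> \<eta>) (\<xi>, \<eta>, \<zeta>)"
      unfolding p oct_cubic_eq_hess[of "nf_2 _", symmetric]
      by (simp only: oct_cubic_nf distrib_left prod.case)
        (simp add: oct_cubic_eq_hess[of "nf_2 _"])
  qed (fact trihomogeneous_oct_cubic_hess)+
  moreover have "inj nf_1" "inj nf_2"
    by (auto simp: inj_def nf_1_def nf_2_def vec7_eq_iff)
  then have "dim (range nf_1) = 4" "dim (range nf_2) = 5"
    using linear_nf by (simp_all add: dim_image_eq)
  ultimately show ?thesis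
    unfolding has_type_def by metis
qed

section \<open>Clifford systems\<close>

text \<open>Conjugation by \<open>B\<close> turns \<open>A\<close> into \<open>- A\<close>, so the
  characteristic polynomial \<open>p\<close> satisfies
  \<open>p(x) = det (x - A) = det (x + A)\<close> and
  \<open>p\<^sup>2 = (x\<^sup>2 - 1) ^ (2 * m)\<close>. Being monic, \<open>p\<close> is
  \<open>(x\<^sup>2 - 1) ^ m\<close>; evaluate at 0.\<close>

lemma det_anticommuting_involutions:
  fixes A B :: "real mat"
  assumes A: "A \<in> carrier_mat (2 * m) (2 * m)" and B: "B \<in> carrier_mat (2 * m) (2 * m)"
    and AA: "A * A = 1\<^sub>m (2 * m)" and BB: "B * B = 1\<^sub>m (2 * m)" and AB: "A * B = - (B * A)"
  shows "Determinant.det A = (-1) ^ m"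
proof -
  let ?n = "2 * m"
  let ?M = "\<lambda>x. x \<cdot>\<^sub>m 1\<^sub>m ?n - A" and ?N = "\<lambda>x. x \<cdot>\<^sub>m 1\<^sub>m ?n + A"
  define p where "p = char_poly A"
  have p: "poly p x = Determinant.det (?M x)" for x
  proof -
    have "- (char_matrix A x) = ?M x"
      using A by (intro eq_matI) (auto simp: char_matrix_def)
    then show ?thesis
      unfolding p_def char_poly_matrix[OF A] by simp
  qed
  have detBB: "Determinant.det B * Determinant.det B = 1"
    using det_mult[OF B B] BB by simp
  have pN: "poly p x = Determinant.det (?N x)" for x
  proof -
    have "B * ?M x = x \<cdot>\<^sub>m B - B * A"
      using A B by (simp add: mult_minus_distrib_mat[OF B _ A] mult_smult_distrib[OF B one_carrier_mat])
    also have "\<dots> = x \<cdot>\<^sub>m B + A * B"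
      unfolding AB using A B by (intro eq_matI) auto
    also have "\<dots> = ?N x * B"
      using A B by (simp add: add_mult_distrib_mat[OF _ A B] mult_smult_assoc_mat[OF one_carrier_mat B])
    finally have "B * ?M x = ?N x * B" .
    then have "Determinant.det B * Determinant.det (?M x) = Determinant.det (?N x) * Determinant.det B"
      using A B by (metis (no_types, lifting) det_mult add_carrier_mat minus_carrier_mat smult_carrier_mat one_carrier_mat)
    with detBB show ?thesis
      by (metis p mult.commute mult_cancel_left zero_neq_one mult_zero_left)
  qed
  have "poly p x * poly p x = (x\<^sup>2 - 1) ^ ?n" for x
  proof -
    have N: "?N x \<in> carrier_mat ?n ?n"
      using A by auto
    have "?M x * ?N x = x \<cdot>\<^sub>m ?N x - A * ?N x"
      using A N by (simp add: minus_mult_distrib_mat[OF _ A N] mult_smult_assoc_mat[OF one_carrier_mat N])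
    also have "A * ?N x = x \<cdot>\<^sub>m A + 1\<^sub>m ?n"
      using A by (simp add: mult_add_distrib_mat[OF A _ A] mult_smult_distrib[OF A one_carrier_mat] AA)
    also have "x \<cdot>\<^sub>m ?N x - (x \<cdot>\<^sub>m A + 1\<^sub>m ?n) = (x\<^sup>2 - 1) \<cdot>\<^sub>m 1\<^sub>m ?n"
      using A by (intro eq_matI) (auto simp: power2_eq_square algebra_simps)
    finally have "?M x * ?N x = (x\<^sup>2 - 1) \<cdot>\<^sub>m 1\<^sub>m ?n" .
    then have "Determinant.det (?M x) * Determinant.det (?N x) = (x\<^sup>2 - 1) ^ ?n"
      using det_mult[of "?M x" ?n "?N x"] A by (simp add: minus_carrier_mat)
    then show ?thesis using p pN by metis
  qed
  then have "poly (p * p) x = poly ([:-1, 0, 1:] ^ m * [:-1, 0, 1:] ^ m) x" for x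
    by (simp add: power2_eq_square power_mult algebra_simps flip: power_mult_distrib)
  then have "p * p = [:-1, 0, 1:] ^ m * [:-1, 0, 1:] ^ m"
    by (simp add: poly_eq_poly_eq_iff[symmetric] fun_eq_iff)
  then have "p = [:-1, 0, 1:] ^ m \<or> p = - ([:-1, 0, 1:] ^ m)"
    by (simp add: square_eq_iff)
  moreover have "lead_coeff p = 1"
    using degree_monic_char_poly[OF A] by (simp add: p_def)
  moreover have "lead_coeff ([:-1, 0, 1:] ^ m :: real poly) = 1"
    by (simp add: lead_coeff_power)
  ultimately have "p = [:-1, 0, 1:] ^ m"
    by (metis lead_coeff_minus one_neq_neg_one)
  moreover have "?N 0 = A"
    using A by (intro eq_matI) auto
  ultimately show ?thesis
    using pN[of 0] by (simp add: poly_power)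
qed

text \<open>
  The matrix \<open>K = (1 + A) J + (1 - A)\<close> satisfies \<open>K\<^sup>2 = - 4 A\<close>, so that \<open>det A\<close> is not negative.
\<close>

lemma even_if_commuting_complex_structure:
  fixes A B J :: "real mat"
  assumes A: "A \<in> carrier_mat (2 * m) (2 * m)" and B: "B \<in> carrier_mat (2 * m) (2 * m)"
    and AA: "A * A = 1\<^sub>m (2 * m)" and BB: "B * B = 1\<^sub>m (2 * m)" and AB: "A * B = - (B * A)"
    and J: "J \<in> carrier_mat (2 * m) (2 * m)" and JJ: "J * J = - 1\<^sub>m (2 * m)" and AJ: "A * J = J * A"
  shows "even m"
proof -
  let ?n = "2 * m"
  \<comment> \<open>On the eigenspace of \<open>A\<close> for 1 this is \<open>2 J\<close>, on the
    one for -1 it is 2, so its square is -4 and 4 respectively.\<close>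
  let ?K = "J + A * J + 1\<^sub>m ?n - A"
  have "?K * ?K = (- 4) \<cdot>\<^sub>m A"
  proof -
    define L where "L = A * J"
    have L: "L \<in> carrier_mat ?n ?n" and I: "1\<^sub>m ?n \<in> carrier_mat ?n ?n"
      and K: "J + L + 1\<^sub>m ?n - A \<in> carrier_mat ?n ?n"
      using A J by (auto simp: L_def)
    have LJ: "L * J = - A"
      using A J by (simp add: L_def assoc_mult_mat[OF A J J] JJ)
    have JA: "J * A = L"
      by (simp add: L_def AJ)
    have AL: "A * L = J"
      using assoc_mult_mat[OF A A J] AA J by (simp add: L_def)
    have LA: "L * A = J"
      using assoc_mult_mat[OF A J A] AL JA by (simp add: L_def)
    have JL: "J * L = - A"
      using assoc_mult_mat[OF J A J] LJ JA by (simp add: L_def)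
    have LL: "L * L = - 1\<^sub>m ?n"
      using assoc_mult_mat[OF L A J] LA JJ by (simp add: L_def)
    have D: "(J + L + 1\<^sub>m ?n - A) * X = J * X + L * X + X - A * X" if "X \<in> carrier_mat ?n ?n" for X
      using that A J L
      by (simp add: minus_mult_distrib_mat[of _ ?n ?n] add_mult_distrib_mat[of _ ?n ?n]
          assoc_add_mat[of _ ?n ?n])
    have E: "X * (J + L + 1\<^sub>m ?n - A) = X * J + X * L + X - X * A" if "X \<in> carrier_mat ?n ?n" for X
      using that A J L
      by (simp add: mult_minus_distrib_mat[of X ?n ?n _ ?n] mult_add_distrib_mat[of X ?n ?n _ ?n]
          assoc_add_mat[of _ ?n ?n])
    have "(J + L + 1\<^sub>m ?n - A) * (J + L + 1\<^sub>m ?n - A) =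
        (J + L + 1\<^sub>m ?n - A) * J + (J + L + 1\<^sub>m ?n - A) * L +
        (J + L + 1\<^sub>m ?n - A) - (J + L + 1\<^sub>m ?n - A) * A"
      by (rule E[OF K])
    also have "\<dots> = (- 4) \<cdot>\<^sub>m A"
      unfolding D[OF J] D[OF L] D[OF A] JJ LJ JL LL JA LA AL AA L_def[symmetric]
      using A J L by (intro eq_matI) auto
    finally show ?thesis unfolding L_def .
  qed
  moreover have "?K \<in> carrier_mat ?n ?n"
    using A J by auto
  ultimately have "Determinant.det ?K * Determinant.det ?K = (- 4) ^ ?n * Determinant.det A"
    using A det_mult[of ?K ?n ?K] by auto
  then have "0 \<le> (- 4) ^ ?n * Determinant.det A"
    by (metis zero_le_square)
  then have nonneg: "0 \<le> 16 ^ m * Determinant.det A"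
    by (simp only: power_mult) simp
  have "0 \<le> Determinant.det A"
  proof (rule ccontr)
    assume "\<not> 0 \<le> Determinant.det A"
    then have "16 ^ m * Determinant.det A < 0"
      by (intro mult_pos_neg) auto
    with nonneg show False by linarith
  qed
  then show ?thesis
    unfolding det_anticommuting_involutions[OF A B AA BB AB]
    by (cases "even m") auto
qed

lemma clifford_system_square:
  assumes "clifford_system m q A" "i \<le> q"
  shows "A i * A i = 1\<^sub>m (2 * m)"
proof -
  have C: "A i \<in> carrier_mat (2 * m) (2 * m)" and E: "A i * A i + A i * A i = 2 \<cdot>\<^sub>m 1\<^sub>m (2 * m)"
    using assms by (auto simp: clifford_system_def)
  show ?thesis
  proof (rule eq_matI)
    fix k l assume kl: "k < dim_row (1\<^sub>m (2 * m) :: real mat)" "l < dim_col (1\<^sub>m (2 * m) :: real mat)"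
    have "(A i * A i + A i * A i) $$ (k, l) = (A i * A i) $$ (k, l) + (A i * A i) $$ (k, l)"
      using C kl by (intro index_add_mat) auto
    moreover have "(A i * A i + A i * A i) $$ (k, l) = 2 * 1\<^sub>m (2 * m) $$ (k, l)"
      unfolding E using kl by simp
    ultimately show "(A i * A i) $$ (k, l) = 1\<^sub>m (2 * m) $$ (k, l)"
      by simp
  qed (use C in auto)
qed

lemma clifford_system_anticommute:
  assumes "clifford_system m q A" "i \<le> q" "j \<le> q" "i \<noteq> j"
  shows "A i * A j = - (A j * A i)"
proof -
  have C: "A i \<in> carrier_mat (2 * m) (2 * m)" "A j \<in> carrier_mat (2 * m) (2 * m)"
    and E: "A i * A j + A j * A i = 0 \<cdot>\<^sub>m 1\<^sub>m (2 * m)"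
    using assms by (auto simp: clifford_system_def)
  show ?thesis
  proof (rule eq_matI)
    fix k l assume "k < dim_row (- (A j * A i))" "l < dim_col (- (A j * A i))"
    then have kl: "k < 2 * m" "l < 2 * m"
      using C by auto
    have "(A i * A j + A j * A i) $$ (k, l) = (A i * A j) $$ (k, l) + (A j * A i) $$ (k, l)"
      using C kl by (intro index_add_mat) auto
    moreover have "(A i * A j + A j * A i) $$ (k, l) = 0"
      unfolding E using kl by simp
    moreover have "(- (A j * A i)) $$ (k, l) = - ((A j * A i) $$ (k, l))"
      using C kl by (intro index_uminus_mat) auto
    ultimately show "(A i * A j) $$ (k, l) = (- (A j * A i)) $$ (k, l)"
      by simp
  qed (use C in auto)
qed

text \<open>\<open>A 1\<close> serves twice: as the involution anticommuting with
  \<open>A 0\<close>, and as a factor of the complex structure \<open>A 1 * A 2\<close>. Passing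
  \<open>A 0\<close> through both factors changes the sign twice.\<close>

lemma clifford_system_even:
  assumes S: "clifford_system m q A" and "2 \<le> q"
  shows "even m"
proof -
  let ?n = "2 * m"
  define X Y Z where "X = A 0" and "Y = A 1" and "Z = A 2"
  have C: "X \<in> carrier_mat ?n ?n" "Y \<in> carrier_mat ?n ?n" "Z \<in> carrier_mat ?n ?n"
    using assms by (auto simp: X_def Y_def Z_def clifford_system_def)
  have sq: "X * X = 1\<^sub>m ?n" "Y * Y = 1\<^sub>m ?n" "Z * Z = 1\<^sub>m ?n"
    using clifford_system_square[OF S] \<open>2 \<le> q\<close> by (auto simp: X_def Y_def Z_def)
  have ac: "X * Y = - (Y * X)" "X * Z = - (Z * X)" "Z * Y = - (Y * Z)"
    unfolding X_def Y_def Z_def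
    by (rule clifford_system_anticommute[OF S]; use \<open>2 \<le> q\<close> in simp)+
  have neg: "(- P) * Q = - (P * Q)" "P * (- Q) = - (P * Q)" if "P \<in> carrier_mat ?n ?n" "Q \<in> carrier_mat ?n ?n" for P Q :: "real mat"
    using that by (auto intro!: eq_matI)
  have "(Y * Z) * (Y * Z) = Y * ((Z * Y) * Z)"
    using C by (simp add: assoc_mult_mat[of _ ?n ?n _ ?n _ ?n])
  also have "(Z * Y) * Z = - (Y * (Z * Z))"
    using C by (simp add: ac(3) neg assoc_mult_mat[of _ ?n ?n _ ?n _ ?n])
  also have "Y * - (Y * (Z * Z)) = - 1\<^sub>m ?n"
    using C by (simp add: sq neg)
  finally have JJ: "(Y * Z) * (Y * Z) = - 1\<^sub>m ?n" .
  have "X * (Y * Z) = (X * Y) * Z"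
    using C by (simp add: assoc_mult_mat[of _ ?n ?n _ ?n _ ?n])
  also have "\<dots> = - (Y * (X * Z))"
    unfolding ac(1) using C by (simp add: neg assoc_mult_mat[of _ ?n ?n _ ?n _ ?n])
  also have "\<dots> = Y * (Z * X)"
    unfolding ac(2) using C by (simp add: neg uminus_uminus_mat)
  also have "\<dots> = (Y * Z) * X"
    using C by (simp add: assoc_mult_mat[of _ ?n ?n _ ?n _ ?n])
  finally have "X * (Y * Z) = (Y * Z) * X" .
  from even_if_commuting_complex_structure[OF C(1,2) sq(1,2) ac(1) _ JJ this] C
  show ?thesis by simp
qed

section \<open>Comparison of Hessians\<close>

text \<open>The third-order polarization. It needs values only, so a congruence transports it
  without the chain rule.\<close>

definition polar :: "('a::plus \<Rightarrow> real) \<Rightarrow> 'a \<Rightarrow> 'a \<Rightarrow> 'a \<Rightarrow> real" where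
  "polar g x y z = g (x + y + z) - g (x + y) - g (x + z) - g (y + z) + g x + g y + g z"

lemma polar_oct_cubic: "polar oct_cubic x y z = oct_cubic_hess x y z"
  by (simp add: polar_def oct_cubic_eq_hess oct_cubic_hess_add oct_cubic_hess_commute field_simps)

lemma sum_Basis_inner_square: "(\<Sum>b\<in>Basis. (y \<bullet> b)\<^sup>2) = (norm (y :: 'a::euclidean_space))\<^sup>2"
  unfolding power2_norm_eq_inner by (subst euclidean_inner) (simp add: power2_eq_square)

text \<open>Summing \<open>norm_oct_cross\<close> over the seven basis vectors \<open>a\<close>
  gives seven squared norms minus one.\<close>

lemma sum_Basis_oct_triple_square:
  "(\<Sum>a\<in>Basis. \<Sum>b\<in>Basis. (oct_triple w a b)\<^sup>2) = 6 * (norm w)\<^sup>2"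
proof -
  have "oct_triple w a b = oct_cross w a \<bullet> b" for a b
    using oct_triple_cyclic[of b w a] by (simp add: oct_triple_def inner_commute)
  then have "(\<Sum>a\<in>Basis. \<Sum>b\<in>Basis. (oct_triple w a b)\<^sup>2) = (\<Sum>a\<in>Basis. (norm w)\<^sup>2 - (w \<bullet> a)\<^sup>2)"
    by (simp add: sum_Basis_inner_square norm_oct_cross dot_square_norm)
  also have "\<dots> = 6 * (norm w)\<^sup>2"
    by (simp add: sum_subtractf sum_Basis_inner_square)
  finally show ?thesis .
qed

lemma sum_Basis_prod:
  "sum g Basis = (\<Sum>i\<in>Basis. g (i, 0)) + (\<Sum>i\<in>Basis. g (0, i))"
  for g :: "'a::euclidean_space \<times> 'b::euclidean_space \<Rightarrow> 'c::comm_monoid_add"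
  unfolding Basis_prod_def
  by (subst sum.union_disjoint) (auto simp: sum.reindex inj_on_def)

text \<open>Six off-diagonal blocks; each of \<open>u\<close>, \<open>v\<close>, \<open>w\<close>
  governs two of them, contributing 6 times its squared norm to each.\<close>

lemma sum_Basis_oct_cubic_hess_square:
  "(\<Sum>a\<in>Basis. \<Sum>b\<in>Basis. (oct_cubic_hess x a b)\<^sup>2) = 12 * (norm x)\<^sup>2"
proof -
  obtain u v w where x: "x = (u, v, w)" by (cases x)
  have sq: "(oct_triple a b w)\<^sup>2 = (oct_triple w a b)\<^sup>2" "(oct_triple b a w)\<^sup>2 = (oct_triple w a b)\<^sup>2"
    "(oct_triple a w b)\<^sup>2 = (oct_triple w a b)\<^sup>2" "(oct_triple b w a)\<^sup>2 = (oct_triple w a b)\<^sup>2"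
    "(oct_triple w b a)\<^sup>2 = (oct_triple w a b)\<^sup>2" for a b w
    using oct_triple_cyclic[of w a b] oct_triple_cyclic[of a b w] oct_triple_swap[of w a b]
      oct_triple_cyclic[of w b a] oct_triple_cyclic[of b a w]
    by (auto simp: power2_eq_iff)
  have swap: "(\<Sum>a\<in>Basis. \<Sum>b\<in>Basis. (oct_triple w b a)\<^sup>2) = 6 * (norm w)\<^sup>2" for w
    by (subst sum.swap) (rule sum_Basis_oct_triple_square)
  show ?thesis
    unfolding sum_Basis_prod x
    by (simp add: sum.distrib oct_cubic_hess_def sq(1)[of _ _ w] sq(2)[of _ _ w] sq(3)[of _ v] sq(4)[of _ v]
      sq(5)[of u] sum_Basis_oct_triple_square swap norm_Pair)
qed

text \<open>The sum of squares of a linear functional over an orthonormal basis is the squared norm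
  of its representing vector, which \<open>U\<close> preserves. This is used in each argument in
  turn.\<close>

lemma sum_Basis_orthogonal_square:
  fixes B :: "'a::euclidean_space \<Rightarrow> 'a \<Rightarrow> real" and U :: "'a \<Rightarrow> 'a"
  assumes B: "bilinear B" and U: "orthogonal_transformation U"
  shows "(\<Sum>a\<in>Basis. \<Sum>b\<in>Basis. (B (U a) (U b))\<^sup>2) = (\<Sum>a\<in>Basis. \<Sum>b\<in>Basis. (B a b)\<^sup>2)"
proof -
  have *: "(\<Sum>b\<in>Basis. (l (U b))\<^sup>2) = (\<Sum>b\<in>Basis. (l b)\<^sup>2)" if "linear l" for l :: "'a \<Rightarrow> real"
  proof -
    define g where "g = adjoint l 1"
    have l: "l x = g \<bullet> x" for x
      using adjoint_works[OF that, of x 1] by (simp add: g_def inner_commute)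
    obtain h where h: "g = U h"
      using orthogonal_transformation_surj[OF U] by (metis surjD)
    have "l (U b) = h \<bullet> b" for b
      using U by (simp add: l h orthogonal_transformation_def)
    moreover have "norm g = norm h"
      using U by (simp add: h orthogonal_transformation_norm)
    ultimately show ?thesis
      by (simp add: l sum_Basis_inner_square)
  qed
  have "(\<Sum>a\<in>Basis. \<Sum>b\<in>Basis. (B (U a) (U b))\<^sup>2) = (\<Sum>b\<in>Basis. \<Sum>a\<in>Basis. (B (U a) b)\<^sup>2)"
    using B by (subst sum.swap) (simp add: * bilinear_def)
  also have "\<dots> = (\<Sum>b\<in>Basis. \<Sum>a\<in>Basis. (B a b)\<^sup>2)"
    using *[of "\<lambda>x. B x _"] B by (simp add: bilinear_def)
  finally show ?thesis
    by (subst sum.swap)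
qed

section \<open>Hessians of Clifford cubics\<close>

lemma sum_lessThan_add:
  "(\<Sum>k<n + p. h k) = (\<Sum>k<n. h k) + (\<Sum>k<p. h (n + k) :: 'a::comm_monoid_add)" for n p :: nat
  by (induction p) (simp_all add: add.assoc)

definition mat_form :: "(nat \<Rightarrow> 'a::real_inner) \<Rightarrow> nat \<Rightarrow> real mat \<Rightarrow> 'a \<Rightarrow> 'a \<Rightarrow> real" where
  "mat_form \<beta> n M x y = (\<Sum>k<n. \<Sum>l<n. M $$ (k, l) * (x \<bullet> \<beta> k) * (y \<bullet> \<beta> l))"

lemma bilinear_mat_form: "bilinear (mat_form \<beta> n M)"
  unfolding bilinear_def linear_iff mat_form_def
  by (simp add: inner_add_left algebra_simps sum.distrib sum_distrib_left)

lemma mat_form_commute: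
  assumes "M \<in> carrier_mat n n" "M\<^sup>T = M"
  shows "mat_form \<beta> n M x y = mat_form \<beta> n M y x"
proof -
  have "M $$ (k, l) = M $$ (l, k)" if "k < n" "l < n" for k l
    using assms that by (metis carrier_matD index_transpose_mat(1))
  then show ?thesis
    unfolding mat_form_def by (subst sum.swap) (auto intro!: sum.cong)
qed

lemma clifford_cubic_on_eq:
  assumes "clifford_system m q A"
  shows "clifford_cubic_on b m q A x =
    (\<Sum>i\<le>q. mat_form (\<lambda>k. b (q + 1 + k)) (2 * m) (A i) x x * (x \<bullet> b i))"
proof -
  have "scalar_prod (Matrix.vec (2 * m) y) (A i *\<^sub>v Matrix.vec (2 * m) y) =
      (\<Sum>k<2 * m. \<Sum>l<2 * m. A i $$ (k, l) * y k * y l)" if "i \<le> q" for i y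
  proof -
    have "A i \<in> carrier_mat (2 * m) (2 * m)"
      using assms that by (auto simp: clifford_system_def)
    then show ?thesis
      by (simp add: scalar_prod_def lessThan_atLeast0 sum_distrib_left mult_ac)
  qed
  then show ?thesis
    by (simp add: clifford_cubic_on_def clifford_cubic_def mat_form_def)
qed

text \<open>The polarization of the Clifford cubic; the factor 2 comes from polarizing the quadratic
  forms in \<open>y\<close>.\<close>

definition clifford_hess where
  "clifford_hess b m q A x y z = 2 * (\<Sum>i\<le>q.
     (x \<bullet> b i) * mat_form (\<lambda>k. b (q + 1 + k)) (2 * m) (A i) y z +
     (y \<bullet> b i) * mat_form (\<lambda>k. b (q + 1 + k)) (2 * m) (A i) x z +
     (z \<bullet> b i) * mat_form (\<lambda>k. b (q + 1 + k)) (2 * m) (A i) x y)"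

lemma polar_clifford_cubic_on:
  assumes S: "clifford_system m q A"
  shows "polar (clifford_cubic_on b m q A) x y z = clifford_hess b m q A x y z"
proof -
  let ?\<beta> = "\<lambda>k. b (q + 1 + k)"
  have "mat_form ?\<beta> (2 * m) (A i) x y = mat_form ?\<beta> (2 * m) (A i) y x" if "i \<le> q" for i x y
    using S that by (intro mat_form_commute) (auto simp: clifford_system_def)
  then show ?thesis
    unfolding polar_def clifford_cubic_on_eq[OF S] clifford_hess_def sum_distrib_left
      sum_subtractf[symmetric] sum.distrib[symmetric]
    using bilinear_mat_form[of ?\<beta>]
    by (intro sum.cong) (simp_all add: bilinear_ladd bilinear_radd inner_add_left algebra_simps)
qed

lemma bilinear_clifford_hess: "bilinear (clifford_hess b m q A x)"
proof -
  define F where "F = mat_form (\<lambda>k. b (q + 1 + k)) (2 * m)"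
  have B: "bilinear (F M)" for M
    unfolding F_def by (rule bilinear_mat_form)
  show ?thesis
    unfolding bilinear_def linear_iff clifford_hess_def F_def[symmetric]
    by (simp add: bilinear_ladd[OF B] bilinear_radd[OF B] bilinear_lmul[OF B] bilinear_rmul[OF B]
      inner_add_left sum.distrib sum_distrib_left algebra_simps)
qed

lemma clifford_system_row:
  assumes S: "clifford_system m q A" and i: "i \<le> q" and k: "k < 2 * m"
  shows "(\<Sum>l<2 * m. (A i $$ (k, l))\<^sup>2) = 1"
proof -
  have C: "A i \<in> carrier_mat (2 * m) (2 * m)" "(A i)\<^sup>T = A i"
    using S i by (auto simp: clifford_system_def)
  have "A i $$ (k, l) = A i $$ (l, k)" if "l < 2 * m" for l
    using C k that by (metis carrier_matD index_transpose_mat(1))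
  then have "(\<Sum>l<2 * m. (A i $$ (k, l))\<^sup>2) = (A i * A i) $$ (k, k)"
    using C k by (simp add: scalar_prod_def lessThan_atLeast0 power2_eq_square)
  then show ?thesis
    using clifford_system_square[OF S i] k by simp
qed

text \<open>At a unit \<open>z\<close>-vector the Hessian is the block \<open>2 A_0\<close> with
  \<open>2 * m\<close> unit rows in \<open>A_0\<close>. At a unit \<open>y\<close>-vector it
  consists of two transposed blocks, whose rows are twice a row of each \<open>A_s\<close>.\<close>

lemma clifford_hess_square:
  fixes b :: "nat \<Rightarrow> 'a::euclidean_space"
  assumes S: "clifford_system m q A" and m: "1 \<le> m" and dim: "(q + 1) + 2 * m = DIM('a)"
    and b: "bij_betw b {..<DIM('a)} Basis"
  defines "T \<equiv> \<lambda>x. \<Sum>a\<in>Basis. \<Sum>a'\<in>Basis. (clifford_hess b m q A x a a')\<^sup>2"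
  shows "T (b 0) = 8 * m" and "T (b (q + 1)) = 8 * (q + 1)"
proof -
  define \<beta> where "\<beta> k = b (q + 1 + k)" for k
  define F where "F = mat_form \<beta> (2 * m)"
  have hess: "clifford_hess b m q A x y z =
      2 * (\<Sum>i\<le>q. (x \<bullet> b i) * F (A i) y z + (y \<bullet> b i) * F (A i) x z + (z \<bullet> b i) * F (A i) x y)" for x y z
    unfolding clifford_hess_def F_def \<beta>_def ..
  have orth: "b s \<bullet> b t = (if s = t then 1 else 0)" if "s < (q + 1) + 2 * m" "t < (q + 1) + 2 * m" for s t
  proof -
    have "b s \<in> Basis" "b t \<in> Basis" "b s = b t \<longleftrightarrow> s = t"
      using b that unfolding dim by (auto simp: bij_betw_def inj_on_eq_iff)
    then show ?thesis
      by (simp add: inner_Basis)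
  qed
  have T: "T x = (\<Sum>s<(q + 1) + 2 * m. \<Sum>t<(q + 1) + 2 * m. (clifford_hess b m q A x (b s) (b t))\<^sup>2)" for x
    unfolding T_def dim by (simp add: sum.reindex_bij_betw[OF b, symmetric])
  have form0: "F M (b s) y = 0" "F M y (b s) = 0" if "s \<le> q" for s y M
    using that by (auto simp: F_def mat_form_def \<beta>_def orth)
  have form: "F M (\<beta> k) (\<beta> l) = M $$ (k, l)" if "k < 2 * m" "l < 2 * m" for k l M
  proof -
    have "F M (\<beta> k) (\<beta> l) =
        (\<Sum>k'<2 * m. \<Sum>l'<2 * m. if l' = l then if k' = k then M $$ (k, l) else 0 else 0)"
      unfolding F_def mat_form_def using that by (intro sum.cong) (auto simp: \<beta>_def orth)
    then show ?thesis using that by simp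
  qed
  have delta: "(\<Sum>i\<le>q. (b s \<bullet> b i) * g i) = g s" if "s \<le> q" for g s
  proof -
    have "(\<Sum>i\<le>q. (b s \<bullet> b i) * g i) = (\<Sum>i\<le>q. if i = s then g s else 0)"
      using that by (intro sum.cong) (auto simp: orth)
    then show ?thesis using that by simp
  qed
  have delta0: "\<beta> k \<bullet> b i = 0" if "k < 2 * m" "i \<le> q" for k i
    using that by (simp add: \<beta>_def orth)
  \<comment> \<open>The form is linear in \<open>z\<close> and quadratic in \<open>y\<close>, so
    only one \<open>z\<close>-argument with two \<open>y\<close>-arguments gives a nonzero
    value.\<close>
  have zzz: "clifford_hess b m q A (b r) (b s) y = 0" if "r \<le> q" "s \<le> q" for r s y
    using that by (simp add: hess form0)
  have zyz: "clifford_hess b m q A (b r) y (b s) = 0" if "r \<le> q" "s \<le> q" for r s y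
    using that by (simp add: hess form0)
  have yzz: "clifford_hess b m q A y (b r) (b s) = 0" if "r \<le> q" "s \<le> q" for r s y
    using that by (simp add: hess form0)
  have zyy: "clifford_hess b m q A (b s) (\<beta> k) (\<beta> l) = 2 * A s $$ (k, l)"
    if "s \<le> q" "k < 2 * m" "l < 2 * m" for s k l
    using that by (simp add: hess form0 form delta delta0)
  have yzy: "clifford_hess b m q A (\<beta> k) (b s) (\<beta> l) = 2 * A s $$ (k, l)"
    if "s \<le> q" "k < 2 * m" "l < 2 * m" for s k l
    using that by (simp add: hess form0 form delta delta0)
  have yyz: "clifford_hess b m q A (\<beta> k) (\<beta> l) (b s) = 2 * A s $$ (k, l)"
    if "s \<le> q" "k < 2 * m" "l < 2 * m" for s k l
    using that by (simp add: hess form0 form delta delta0)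
  have yyy: "clifford_hess b m q A (\<beta> k) (\<beta> l) (\<beta> j) = 0"
    if "k < 2 * m" "l < 2 * m" "j < 2 * m" for k l j
    using that by (simp add: hess delta0)
  have row: "(\<Sum>l<2 * m. 4 * (A i $$ (k, l))\<^sup>2) = 4" if "i \<le> q" "k < 2 * m" for i k
    using clifford_system_row[OF S that] by (simp flip: sum_distrib_left)
  have "T (b 0) = (\<Sum>k<2 * m. \<Sum>l<2 * m. 4 * (A 0 $$ (k, l))\<^sup>2)"
    unfolding T sum_lessThan_add[of _ "q + 1"] \<beta>_def[symmetric] by (simp add: zzz zyz zyy cong: sum.cong_simp)
  also have "\<dots> = 8 * m"
    by (simp add: row cong: sum.cong_simp)
  finally show "T (b 0) = 8 * m" .
  have "T (\<beta> 0) = (\<Sum>s<q + 1. \<Sum>l<2 * m. 4 * (A s $$ (0, l))\<^sup>2) + (\<Sum>l<2 * m. \<Sum>s<q + 1. 4 * (A s $$ (0, l))\<^sup>2)"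
    unfolding T sum_lessThan_add[of _ "q + 1"] \<beta>_def[symmetric] using m by (simp add: yzz yyz yzy yyy cong: sum.cong_simp)
  also have "\<dots> = 2 * (\<Sum>s<q + 1. \<Sum>l<2 * m. 4 * (A s $$ (0, l))\<^sup>2)"
    by (subst (2) sum.swap) simp
  also have "\<dots> = 8 * (q + 1)"
    using m by (simp add: row cong: sum.cong_simp)
  finally show "T (b (q + 1)) = 8 * (q + 1)" by (simp add: \<beta>_def)
qed

text \<open>For the octonion cubic the squared Frobenius norm is the same at all unit vectors.
  Comparing a \<open>z\<close>-vector with a \<open>y\<close>-vector gives \<open>m = q + 1\<close>,
  so \<open>3 * m = 21\<close>, and \<open>m = 7\<close> is odd.\<close>

lemma not_congruent_clifford_cubic_on:
  assumes S: "clifford_system m q A" and m: "1 \<le> m" and dim: "(q + 1) + 2 * m = DIM(oct3)"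
    and b: "bij_betw b {..<DIM(oct3)} Basis"
  shows "\<not> congruent_forms oct_cubic (clifford_cubic_on b m q A)"
proof
  assume "congruent_forms oct_cubic (clifford_cubic_on b m q A)"
  then obtain U c where U: "orthogonal_transformation U" and c: "c \<noteq> 0"
    and eq: "\<And>x. oct_cubic x = c * clifford_cubic_on b m q A (U x)"
    unfolding congruent_forms_def by blast
  let ?T = "\<lambda>x. \<Sum>a\<in>Basis. \<Sum>a'\<in>Basis. (clifford_hess b m q A x a a')\<^sup>2"
  have hess: "oct_cubic_hess x y z = c * clifford_hess b m q A (U x) (U y) (U z)" for x y z
    using orthogonal_transformation_linear[OF U]
    unfolding polar_oct_cubic[symmetric] polar_clifford_cubic_on[OF S, symmetric] polar_def eq
    by (simp add: linear_add algebra_simps)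
  have T: "c\<^sup>2 * ?T X = 12" if "X \<in> Basis" for X
  proof -
    obtain x where x: "X = U x"
      using orthogonal_transformation_surj[OF U] by (metis surjD)
    have "12 * (norm x)\<^sup>2 = c\<^sup>2 * (\<Sum>a\<in>Basis. \<Sum>a'\<in>Basis. (clifford_hess b m q A X (U a) (U a'))\<^sup>2)"
      unfolding sum_Basis_oct_cubic_hess_square[symmetric] hess x
      by (simp add: power_mult_distrib sum_distrib_left)
    moreover have "norm x = 1"
      using that U x by (metis norm_Basis orthogonal_transformation_norm)
    ultimately show ?thesis
      by (simp add: sum_Basis_orthogonal_square[OF bilinear_clifford_hess U])
  qed
  have "b 0 \<in> Basis" "b (q + 1) \<in> Basis"
    using b dim m by (auto simp: bij_betw_def)
  from this[THEN T] have "c\<^sup>2 * real (8 * m) = c\<^sup>2 * real (8 * (q + 1))"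
    unfolding clifford_hess_square[OF S m dim b] by simp
  with c have "real (8 * m) = real (8 * (q + 1))"
    by simp
  then have "8 * m = 8 * (q + 1)"
    by (simp only: of_nat_eq_iff)
  then have "m = q + 1"
    by simp
  with dim have "m = 7" "q = 6"
    by simp_all
  with clifford_system_even[OF S] show False by simp
qed

theorem proposition6p3:
  fixes f :: "(real ^ 7) \<times> (real ^ 7) \<times> (real ^ 7) \<Rightarrow> real"
  assumes "\<And>u v w. f (u, v, w) = oct_re (oct_of u *\<^sub>o (oct_of v *\<^sub>o oct_of w))"
  shows "radial_eigencubic f \<and> exceptional f \<and> has_type f (4, 5)"
proof -
  have "f = oct_cubic"
    using assms by (auto simp: fun_eq_iff oct_re_mult_imaginary oct_cubic_def)
  then show ?thesis
    using radial_eigencubic_oct_cubic has_type_oct_cubic not_congruent_clifford_cubic_on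
    unfolding exceptional_def by blast
qed

end
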